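(* Let $\alpha$ be a real number with $0\leq\alpha\leq 1$, and let $B$ be a finite nonempty subset of $\mathbb{N}$. Then there exists a set $A\subset\mathbb{N}$ such that the sumset $A+B$ has an asymptotic density and $d(A+B)=\alpha$.
   Context: $\mathbb{N}:=\{0,1,2,\dots\}$. For $A,B\subset\mathbb{N}$, the sumset is $A+B:=\{a+b : a\in A,\ b\in B\}$. For $X\subset\mathbb{N}$ and real $x\geq 1$, put $X(x):=|X\cap[1,x]|$ (the number of elements of $X$ in $[1,x]$), and $X(x):=0$ for $x<1$. The asymptotic (natural) density of $X$ is $dX=d(X):=\lim_{x\to+\infty} X(x)/x$, provided this limit exists; an equality $d(X)=c$ includes the assertion that the limit exists. *)

theory Defs
  imports Complex_Main "HOL-Library.Set_Algebras"
begin

text \<open>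
  The sumset of two sets of naturals is \<open>A + B\<close> from \<^theory>\<open>HOL-Library.Set_Algebras\<close>.
\<close>

text \<open>
  The element \<open>0\<close> is never counted, and the count is \<open>0\<close> for \<open>x < 1\<close> because the interval
  \<open>[1, x]\<close> is then empty.
\<close>
definition counting :: "nat set \<Rightarrow> real \<Rightarrow> nat" where
  "counting X x = card {n \<in> X. 1 \<le> real n \<and> real n \<le> x}"

text \<open>
  A relation rather than a function, so that \<open>has_density X c\<close> includes the existence of the limit.
\<close>
definition has_density :: "nat set \<Rightarrow> real \<Rightarrow> bool" where
  "has_density X c \<longleftrightarrow> ((\<lambda>x::real. real (counting X x) / x) \<longlongrightarrow> c) at_top"

end

(* The set A is built greedily: n joins A iff the sumset of B with the part of A chosen so far
   then still has at most \<alpha> (n + 1) elements. Adding a new largest element enlarges the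
   sumset by at least 1 and at most |B|, so the size of the sumset stays within |B| of \<alpha> n,
   and it differs from the counting function of A + B by at most a constant. *)
theory Submission
  imports Defs
begin

lemma finite_sumset:
  fixes X B :: "nat set"
  assumes "finite X" "finite B"
  shows "finite (X + B)"
  using assms by (simp add: finite_set_plus)

lemma insert_sumset: "insert n X + B = (+) n ` B \<union> (X + B)" for n :: nat
  by (auto simp: set_plus_def)

lemma card_insert_sumset_le:
  fixes n :: nat
  assumes "finite X" "finite B"
  shows "card (insert n X + B) \<le> card (X + B) + card B"
proof -
  have "card (insert n X + B) \<le> card ((+) n ` B) + card (X + B)"
    unfolding insert_sumset by (rule card_Un_le)
  also have "card ((+) n ` B) \<le> card B"
    using assms by (intro card_image_le)
  finally show ?thesis by simp
qed

text \<open>Every element of \<open>X + B\<close> is below \<open>n + Max B\<close>, because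
  \<open>X\<close> lies below \<open>n\<close>; so this sum is new.\<close>

lemma card_insert_sumset_ge:
  fixes n :: nat
  assumes "X \<subseteq> {..<n}" "finite B" "B \<noteq> {}"
  shows "Suc (card (X + B)) \<le> card (insert n X + B)"
proof -
  have fin: "finite (X + B)"
    using assms finite_sumset finite_subset by blast
  have new: "n + Max B \<notin> X + B"
  proof
    assume "n + Max B \<in> X + B"
    then obtain x b where "x \<in> X" "b \<in> B" "n + Max B = x + b"
      by (rule set_plus_elim)
    moreover from this have "x < n" "b \<le> Max B"
      using assms by auto
    ultimately show False by simp
  qed
  have "insert (n + Max B) (X + B) \<subseteq> insert n X + B"
    using assms(2,3) by (auto simp: insert_sumset)
  moreover have "finite (insert n X + B)"
    using assms fin by (simp add: insert_sumset)
  ultimately have "card (insert (n + Max B) (X + B)) \<le> card (insert n X + B)"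
    by (intro card_mono)
  with new fin show ?thesis by simp
qed

text \<open>Stage \<open>n\<close> has settled exactly the numbers below \<open>n\<close>. The test
  counts the whole finite sumset, including its elements beyond \<open>n\<close>.\<close>

primrec greedy :: "real \<Rightarrow> nat set \<Rightarrow> nat \<Rightarrow> nat set" where
  "greedy \<alpha> B 0 = {}"
| "greedy \<alpha> B (Suc n) =
    (if real (card (insert n (greedy \<alpha> B n) + B)) \<le> \<alpha> * real (Suc n)
     then insert n (greedy \<alpha> B n) else greedy \<alpha> B n)"

lemma greedy_subset: "greedy \<alpha> B n \<subseteq> {..<n}"
  by (induction n) (auto simp: less_Suc_eq)

lemma greedy_mono: "m \<le> n \<Longrightarrow> greedy \<alpha> B m \<subseteq> greedy \<alpha> B n"
  by (rule lift_Suc_mono_le) auto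

text \<open>Membership of \<open>k\<close> is decided once, at stage \<open>Suc k\<close>. This
  allows an unknown stage to be replaced by any \<open>m > k\<close>, even a smaller one.\<close>

lemma mem_greedy_less:
  assumes "k \<in> greedy \<alpha> B n" "k < m"
  shows "k \<in> greedy \<alpha> B m"
  using assms
proof (induction n)
  case (Suc n)
  show ?case
  proof (cases "k \<in> greedy \<alpha> B n")
    case False
    with Suc.prems have "k = n"
      by (simp split: if_splits)
    with Suc.prems greedy_mono[of "Suc n" m \<alpha> B] show ?thesis
      by (meson Suc_leI subsetD)
  qed (use Suc in blast)
qed simp

text \<open>An accepted number has passed exactly this test; a rejected one leaves the sumset
  unchanged while the bound does not decrease.\<close>

lemma card_greedy_sumset_le:
  assumes "0 \<le> \<alpha>"
  shows "real (card (greedy \<alpha> B n + B)) \<le> \<alpha> * real n"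
proof (induction n)
  case (Suc n)
  then show ?case
    using assms by (auto simp: algebra_simps)
qed (simp add: set_plus_def)

text \<open>On acceptance the cardinality grows by at least 1, hence by at least \<alpha>. On
  rejection the enlarged sumset would exceed \<alpha> (n + 1), and it has at most
  \<open>card B\<close> more elements than the current one.\<close>

lemma card_greedy_sumset_ge:
  assumes "\<alpha> \<le> 1" "finite B" "B \<noteq> {}"
  shows "\<alpha> * real n - real (card B) \<le> real (card (greedy \<alpha> B n + B))"
proof (induction n)
  case (Suc n)
  let ?G = "greedy \<alpha> B n"
  have "Suc (card (?G + B)) \<le> card (insert n ?G + B)"
    by (rule card_insert_sumset_ge[OF greedy_subset assms(2,3)])
  moreover have "card (insert n ?G + B) \<le> card (?G + B) + card B"
    using finite_subset[OF greedy_subset] assms(2)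
    by (intro card_insert_sumset_le) auto
  ultimately show ?case
    using Suc assms(1) by (simp add: distrib_left)
qed simp

text \<open>Dividing by \<open>x\<close> turns the bound \<open>K\<close> into \<open>K / x\<close>,
  which tends to 0.\<close>

lemma has_density_if_bounded_deviation:
  assumes "\<And>x. 0 \<le> x \<Longrightarrow> \<bar>real (counting X x) - c * x\<bar> \<le> K"
  shows "has_density X c"
proof -
  have "((\<lambda>x::real. K / x) \<longlongrightarrow> 0) at_top"
    by (intro tendsto_divide_0[OF tendsto_const] filterlim_at_top_imp_at_infinity filterlim_ident)
  moreover have "\<forall>\<^sub>F x in at_top. dist (real (counting X x) / x) c \<le> dist (K / x) 0"
    using eventually_gt_at_top[of 0]
  proof eventually_elim
    case (elim x)
    then have "real (counting X x) / x - c = (real (counting X x) - c * x) / x"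
      by (simp add: field_simps)
    then show ?case
      using elim assms[of x] by (simp add: dist_real_def divide_right_mono)
  qed
  ultimately show ?thesis
    unfolding has_density_def by (rule metric_tendsto_imp_tendsto)
qed

lemma counting_eq_card_floor:
  assumes "0 \<le> x"
  shows "counting X x = card (X \<inter> {1..nat \<lfloor>x\<rfloor>})"
proof -
  have "{n \<in> X. 1 \<le> real n \<and> real n \<le> x} = X \<inter> {1..nat \<lfloor>x\<rfloor>}"
    using assms by (auto simp: le_nat_floor le_floor_iff nat_le_iff) linarith
  then show ?thesis
    by (simp add: counting_def)
qed

theorem theorem1p2:
  fixes \<alpha> :: real and B :: "nat set"
  assumes "0 \<le> \<alpha>" and "\<alpha> \<le> 1"
    and "finite B" and "B \<noteq> {}"
  shows "\<exists>A :: nat set. has_density (A + B) \<alpha>"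
proof
  let ?G = "greedy \<alpha> B"
  let ?A = "\<Union>n. ?G n"
  \<comment> \<open>The lower bound loses \<open>card B\<close> to the greedy choice, at most
    \<open>Max B + 1\<close> in passing from \<open>x\<close> to the stage \<open>n\<close> below,
    and 1 for the uncounted element 0.\<close>
  let ?K = "real (Max B + card B + 2)"
  have finG: "finite (?G n + B)" for n
    using finite_subset[OF greedy_subset] assms(3) by (intro finite_sumset) auto
  show "has_density (?A + B) \<alpha>"
  proof (rule has_density_if_bounded_deviation)
    fix x :: real
    assume x: "0 \<le> x"
    define m where "m = nat \<lfloor>x\<rfloor>"
    have m: "real m \<le> x" "x < real m + 1"
      using x unfolding m_def by linarith+
    have counting: "counting (?A + B) x = card ((?A + B) \<inter> {1..m})"
      using x by (simp add: counting_eq_card_floor m_def)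

    \<comment> \<open>A sum \<open>a + b\<close> of size at most \<open>m\<close> has
      \<open>a < Suc m\<close>, so \<open>a\<close> is already present at stage
      \<open>Suc m\<close>.\<close>
    have "(?A + B) \<inter> {1..m} \<subseteq> ?G (Suc m) + B"
    proof
      fix y
      assume "y \<in> (?A + B) \<inter> {1..m}"
      then obtain a b n where "y = a + b" "a \<in> ?G n" "b \<in> B" "y \<le> m"
        by (auto elim!: set_plus_elim)
      then show "y \<in> ?G (Suc m) + B"
        using mem_greedy_less[of a \<alpha> B n "Suc m"] by (simp add: set_plus_intro)
    qed
    then have "card ((?A + B) \<inter> {1..m}) \<le> card (?G (Suc m) + B)"
      by (intro card_mono finG)
    moreover have "real (card (?G (Suc m) + B)) \<le> \<alpha> * real (Suc m)"
      using assms(1) by (rule card_greedy_sumset_le)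
    moreover have "\<alpha> * real (Suc m) \<le> \<alpha> * (x + 1)"
      using m assms(1) by (intro mult_left_mono) auto
    ultimately have upper: "real (counting (?A + B) x) \<le> \<alpha> * x + 1"
      using assms(2) counting by (simp add: distrib_left)

    \<comment> \<open>At this stage all sums stay below \<open>m\<close>. If
      \<open>m < Max B\<close>, the subtraction truncates to 0 and the stage is empty; truncation
      only raises \<open>real n\<close>, so the lower bound survives.\<close>
    define n where "n = m - Max B"
    have "?G n + B \<subseteq> insert 0 ((?A + B) \<inter> {1..m})"
    proof
      fix y
      assume "y \<in> ?G n + B"
      then obtain a b where y: "y = a + b" "a \<in> ?G n" "b \<in> B"
        by (rule set_plus_elim)
      moreover have "a < n" "b \<le> Max B"
        using y greedy_subset[of \<alpha> B n] assms(3) by auto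
      ultimately show "y \<in> insert 0 ((?A + B) \<inter> {1..m})"
        unfolding n_def by (auto intro!: set_plus_intro)
    qed
    then have "card (?G n + B) \<le> card (insert 0 ((?A + B) \<inter> {1..m}))"
      by (intro card_mono) auto
    also have "\<dots> \<le> Suc (counting (?A + B) x)"
      unfolding counting by (rule card_insert_le_m1) auto
    finally have "real (card (?G n + B)) \<le> real (counting (?A + B) x) + 1"
      by simp
    moreover have "\<alpha> * real n - real (card B) \<le> real (card (?G n + B))"
      using assms(2-4) by (rule card_greedy_sumset_ge)
    moreover have "\<alpha> * (x - 1 - real (Max B)) \<le> \<alpha> * real n"
      using m assms(1) unfolding n_def by (intro mult_left_mono) linarith+
    moreover have "\<alpha> * (1 + real (Max B)) \<le> 1 * (1 + real (Max B))"
      using assms(2) by (intro mult_right_mono) auto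
    ultimately have "\<alpha> * x - ?K \<le> real (counting (?A + B) x)"
      by (simp add: algebra_simps)
    with upper show "\<bar>real (counting (?A + B) x) - \<alpha> * x\<bar> \<le> ?K"
      by (simp add: abs_le_iff)
  qed
qed

end
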